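(* Let $m,n\in\mathbb{N}_0$, and let $a>1$ and $b$ be real numbers with $\frac1a+\frac1b=1$ such that $\frac{m}{a}+\frac{n}{b}\in\mathbb{N}_0$. Then for all $x,y>0$, $$\left|\beta^{\left(\frac{m}{a}+\frac{n}{b}\right)}\left(\frac{x}{a}+\frac{y}{b}\right)\right|\le\left|\beta^{(m)}(x)\right|^{\frac1a}\left|\beta^{(n)}(y)\right|^{\frac1b}.$$
   Context: Nielsen's $\beta$-function is the function $\beta:(0,\infty)\to\mathbb{R}$ defined by $\beta(x)=\int_0^1 \frac{t^{x-1}}{1+t}\,dt=\int_0^\infty\frac{e^{-xt}}{1+e^{-t}}\,dt$ for $x>0$. For $m\in\mathbb{N}_0=\{0,1,2,\dots\}$, $\beta^{(m)}$ denotes its $m$-th derivative, with $\beta^{(0)}=\beta$. *)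

theory Defs
  imports "HOL-Analysis.Analysis"
begin

(* Nielsen's beta function. It is meant for x > 0 only, where the integrand is
   Lebesgue integrable; for x <= 0 the integral diverges and the value is the
   library's default. The derivatives at a point x > 0 depend only on the values near x. *)
definition nielsen_beta :: "real \<Rightarrow> real" where
  "nielsen_beta x = (LBINT t:{0<..<1}. t powr (x - 1) / (1 + t))"

end

theory Submission
  imports Defs
begin

text \<open>
  Differentiating under the integral sign \<open>m\<close> times brings down a factor
  \<open>(ln t) ^ m\<close>, which has constant sign on \<open>(0, 1)\<close>. Hence
  \<open>\<bar>\<beta>\<^sup>(\<^sup>m\<^sup>) (x)\<bar>\<close> is the integral over \<open>(0, 1)\<close> of the nonnegative function
  \<open>(- ln t) ^ m * t powr (x - 1) / (1 + t)\<close>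
  (lemma \<open>abs_higher_deriv_nielsen_beta\<close>).

  Apart from the fixed factor \<open>1 / (1 + t)\<close>, this integrand is log-affine in the pair
  \<open>(m, x)\<close>. As \<open>1 / a + 1 / b = 1\<close>, the integrand with parameters
  \<open>(m / a + n / b, x / a + y / b)\<close> is therefore exactly the weighted geometric mean of those
  with parameters \<open>(m, x)\<close> and \<open>(n, y)\<close>
  (lemma \<open>log_kernel_geometric_mean\<close>), and the claim is Hoelder's inequality
  (lemma \<open>integral_powr_mult_powr_le\<close>) for these two functions.

  The analytic work is in the differentiation: a second-order Taylor estimate of the integrand,
  whose error term is again a function of the same family and hence integrable, gives the
  derivative directly.
\<close>

section \<open>Hoelder's inequality in weighted form\<close>

text \<open>
  Hoelder's inequality with exponents \<open>1 / p\<close> and \<open>1 / q\<close>: after normalising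
  \<open>f\<close> and \<open>g\<close> to integral one, it is the integral of the pointwise weighted
  inequality between the geometric and the arithmetic mean. If one of the integrals vanishes, then
  so does the integrand on the left almost everywhere.
\<close>
lemma integral_powr_mult_powr_le:
  fixes f g :: "'a \<Rightarrow> real" and p q :: real
  assumes f: "integrable M f" and g: "integrable M g"
    and f0: "\<And>t. f t \<ge> 0" and g0: "\<And>t. g t \<ge> 0"
    and p: "p > 0" and q: "q > 0" and pq: "p + q = 1"
  shows "(LINT t|M. f t powr p * g t powr q) \<le> (LINT t|M. f t) powr p * (LINT t|M. g t) powr q"
proof -
  define F where "F = (LINT t|M. f t)"
  define G where "G = (LINT t|M. g t)"
  let ?h = "\<lambda>t. f t powr p * g t powr q"
  have [measurable]: "f \<in> borel_measurable M" "g \<in> borel_measurable M"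
    using f g by auto
  have FG0: "F \<ge> 0" "G \<ge> 0"
    unfolding F_def G_def using f0 g0 by (auto intro: integral_nonneg_AE)
  show ?thesis
  proof (cases "F = 0 \<or> G = 0")
    case True
    then have "AE t in M. f t = 0 \<or> g t = 0"
    proof
      assume "F = 0"
      then have "AE t in M. f t = 0"
        using integral_nonneg_eq_0_iff_AE[OF f] f0 by (simp add: F_def)
      then show ?thesis by eventually_elim simp
    next
      assume "G = 0"
      then have "AE t in M. g t = 0"
        using integral_nonneg_eq_0_iff_AE[OF g] g0 by (simp add: G_def)
      then show ?thesis by eventually_elim simp
    qed
    then have "AE t in M. ?h t = 0"
      by eventually_elim auto
    then have "(LINT t|M. ?h t) = 0"
      by (rule integral_eq_zero_AE)
    then show ?thesis by simp
  next
    case False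
    with FG0 have F: "F > 0" and G: "G > 0" by auto
    define C where "C = F powr p * G powr q"
    have C: "C > 0" using F G by (simp add: C_def)
    have young: "?h t \<le> C * (p * (f t / F) + q * (g t / G))" for t
    proof -
      have "(f t / F) powr p * (g t / G) powr q \<le> p * (f t / F) + q * (g t / G)"
        using Youngs_inequality_0[of p q "f t / F" "g t / G"] p q pq f0 g0 F G
        by (cases "f t = 0 \<or> g t = 0") (auto simp: less_le)
      moreover have "?h t = C * ((f t / F) powr p * (g t / G) powr q)"
        using F G f0 g0 by (simp add: C_def powr_divide)
      ultimately show ?thesis using C by simp
    qed
    have int: "integrable M (\<lambda>t. C * (p * (f t / F) + q * (g t / G)))"
      using f g by auto
    have "(LINT t|M. ?h t) \<le> (LINT t|M. C * (p * (f t / F) + q * (g t / G)))"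
    proof (rule integral_mono[OF _ int young])
      show "integrable M ?h"
        by (rule Bochner_Integration.integrable_bound[OF int])
          (use young in \<open>auto intro!: AE_I2 intro: order_trans[OF _ abs_ge_self]\<close>)
    qed
    also have "\<dots> = C * (p * (F / F) + q * (G / G))"
      using f g by (simp add: F_def G_def)
    also have "\<dots> = C"
      using F G pq by simp
    finally show ?thesis by (simp add: C_def F_def G_def)
  qed
qed

section \<open>Logarithmic moments of the integrand\<close>

text \<open>
  On \<open>(0, 1)\<close> this is \<open>(- 1) ^ m\<close> times the \<open>m\<close>-th partial derivative in
  \<open>x\<close> of the integrand of Nielsen's beta function; using \<open>- ln t\<close> makes it
  nonnegative.
\<close>
definition log_kernel :: "nat \<Rightarrow> real \<Rightarrow> real \<Rightarrow> real" where
  "log_kernel m x t = (- ln t) ^ m * t powr (x - 1) / (1 + t)"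

definition log_moment :: "nat \<Rightarrow> real \<Rightarrow> real" where
  "log_moment m x = (LBINT t:{0<..<1}. log_kernel m x t)"

lemma log_kernel_nonneg: "0 < t \<Longrightarrow> t < 1 \<Longrightarrow> log_kernel m x t \<ge> 0"
  by (simp add: log_kernel_def)

lemma set_integrable_powr_unit_interval:
  fixes s :: real
  assumes "s > 0"
  shows "set_integrable lborel {0<..<1} (\<lambda>t. t powr (s - 1))"
proof -
  have "(\<lambda>t. t powr (s - 1)) absolutely_integrable_on {0<..1}"
    by (intro nonnegative_absolutely_integrable_1 integrable_on_powr_from_0') (use assms in auto)
  then have "set_integrable lebesgue {0<..<1} (\<lambda>t. t powr (s - 1))"
    by (rule set_integrable_subset) auto
  then show ?thesis
    unfolding set_integrable_def by (subst (asm) integrable_completion) auto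
qed

text \<open>
  A power of \<open>- ln t\<close> is absorbed by an arbitrarily small negative power of \<open>t\<close>; giving
  away half of the exponent \<open>x\<close> for this leaves the integrable majorant
  \<open>t powr (x / 2 - 1)\<close>.
\<close>
lemma set_integrable_log_kernel:
  assumes x: "x > 0"
  shows "set_integrable lborel {0<..<1} (log_kernel m x)"
proof -
  \<comment> \<open>The \<open>m\<close>-th power of \<open>c * w \<le> exp (c * w)\<close> must cost at most
    \<open>exp (x / 2 * w)\<close>, so \<open>m * c \<le> x / 2\<close>; the \<open>+ 1\<close> covers \<open>m = 0\<close>.\<close>
  define c where "c = x / (2 * (real m + 1))"
  have c: "c > 0" "real m * c \<le> x / 2"
    using x by (auto simp: c_def field_simps)
  have bound: "log_kernel m x t \<le> (1 / c) ^ m * t powr (x / 2 - 1)" if t: "0 < t" "t < 1" for t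
  proof -
    define w where "w = - ln t"
    have w: "w > 0" using t by (simp add: w_def)
    have "(c * w) ^ m \<le> exp (c * w) ^ m"
      using c w by (intro power_mono) (auto intro: order_trans[OF _ exp_ge_add_one_self])
    also have "\<dots> = exp (real m * c * w)"
      by (simp add: exp_of_nat_mult mult.assoc)
    also have "\<dots> \<le> exp (x / 2 * w)"
      using c w by (intro exp_le_cancel_iff[THEN iffD2] mult_right_mono) auto
    also have "\<dots> = t powr (- x / 2)"
      using t by (simp add: powr_def w_def)
    finally have "w ^ m \<le> (1 / c) ^ m * t powr (- x / 2)"
      using c by (simp add: power_mult_distrib power_divide field_simps)
    then have "w ^ m * t powr (x - 1) \<le> (1 / c) ^ m * t powr (- x / 2) * t powr (x - 1)"
      by (intro mult_right_mono) auto
    also have "\<dots> = (1 / c) ^ m * t powr (x / 2 - 1)"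
      by (simp add: mult.assoc flip: powr_add)
    finally have "w ^ m * t powr (x - 1) \<le> (1 / c) ^ m * t powr (x / 2 - 1)" .
    moreover have "log_kernel m x t \<le> w ^ m * t powr (x - 1)"
      using t w by (auto simp: log_kernel_def w_def[symmetric] divide_le_eq mult_left_mono
        intro!: mult_left_mono[of 1 "1 + t" "w ^ m * t powr (x - 1)", simplified])
    ultimately show ?thesis by linarith
  qed
  have "set_integrable lborel {0<..<1} (\<lambda>t. (1 / c) ^ m * t powr (x / 2 - 1))"
    using set_integrable_powr_unit_interval[of "x / 2"] x by simp
  then show ?thesis
  proof (rule set_integrable_bound)
    show "set_borel_measurable lborel {0<..<1} (log_kernel m x)"
      unfolding set_borel_measurable_def log_kernel_def by measurable
    show "AE t in lborel. t \<in> {0<..<1} \<longrightarrow>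
        norm (log_kernel m x t) \<le> norm ((1 / c) ^ m * t powr (x / 2 - 1))"
      using bound log_kernel_nonneg c by (auto intro!: AE_I2)
  qed
qed

section \<open>Differentiation under the integral sign\<close>

lemma abs_exp_minus_linear_le:
  fixes u :: real
  shows "\<bar>exp u - 1 - u\<bar> \<le> u\<^sup>2 * exp \<bar>u\<bar>"
proof -
  obtain v where v: "\<bar>v\<bar> \<le> \<bar>u\<bar>" "exp u = (\<Sum>i<2. u ^ i / fact i) + exp v / fact 2 * u ^ 2"
    using Maclaurin_exp_le[of u 2] by blast
  then have "exp u - 1 - u = exp v / 2 * u\<^sup>2"
    by (simp add: numeral_2_eq_2)
  then have "\<bar>exp u - 1 - u\<bar> = exp v / 2 * u\<^sup>2"
    by (simp only: abs_mult) simp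
  also have "\<dots> \<le> exp \<bar>u\<bar> * u\<^sup>2"
  proof (intro mult_right_mono)
    have "exp v \<le> exp \<bar>u\<bar>" using v(1) by simp
    then show "exp v / 2 \<le> exp \<bar>u\<bar>" using exp_gt_zero[of v] by linarith
  qed simp
  finally show ?thesis by (simp add: mult.commute)
qed

text \<open>
  With \<open>w = - ln t\<close>, moving \<open>x\<close> to \<open>x + h\<close> multiplies the kernel by
  \<open>exp (- h * w)\<close>. The remainder of the exponential contributes \<open>(h * w)\<^sup>2\<close>, which
  raises \<open>m\<close> by two, and \<open>exp (\<bar>h\<bar> * w) \<le> t powr (- x / 2)\<close>, which
  lowers \<open>x\<close> to \<open>x / 2\<close>. The bound depends on \<open>h\<close> only through
  \<open>h\<^sup>2\<close>, so it can be integrated in \<open>t\<close>.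
\<close>
lemma log_kernel_taylor:
  assumes t: "0 < t" "t < 1" and h: "\<bar>h\<bar> \<le> x / 2"
  shows "\<bar>log_kernel m (x + h) t - log_kernel m x t + h * log_kernel (Suc m) x t\<bar>
           \<le> h\<^sup>2 * log_kernel (m + 2) (x / 2) t"
proof -
  define w where "w = - ln t"
  have w: "w > 0" using t by (simp add: w_def)
  define K where "K = w ^ m / (1 + t)"
  have K: "K \<ge> 0" using t w by (simp add: K_def)
  have kernel: "log_kernel (m + j) z t = w ^ j * K * exp (- (z - 1) * w)" for j z
    using t by (simp add: log_kernel_def K_def w_def powr_def power_add algebra_simps)
  have "log_kernel m (x + h) t - log_kernel m x t + h * log_kernel (Suc m) x t
      = K * exp (- (x - 1) * w) * (exp (- h * w) - 1 - (- h * w))"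
    using kernel[of 0 "x + h"] kernel[of 0 x] kernel[of 1 x]
    by (simp add: algebra_simps flip: exp_add)
  then have "\<bar>log_kernel m (x + h) t - log_kernel m x t + h * log_kernel (Suc m) x t\<bar>
      = K * exp (- (x - 1) * w) * \<bar>exp (- h * w) - 1 - (- h * w)\<bar>"
    using K by (simp add: abs_mult)
  also have "\<dots> \<le> K * exp (- (x - 1) * w) * ((- h * w)\<^sup>2 * exp \<bar>- h * w\<bar>)"
    using K by (intro mult_left_mono abs_exp_minus_linear_le) auto
  also have "\<dots> \<le> K * exp (- (x - 1) * w) * ((- h * w)\<^sup>2 * exp (x / 2 * w))"
    using K w h by (intro mult_left_mono) (auto simp: abs_mult)
  also have "\<dots> = h\<^sup>2 * (w\<^sup>2 * K * exp (- (x / 2 - 1) * w))"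
    by (simp add: power_mult_distrib algebra_simps flip: exp_add)
  finally show ?thesis using kernel[of 2 "x / 2"] by simp
qed

text \<open>
  Integrating the Taylor estimate bounds the error of the linear approximation by a constant times
  \<open>h\<^sup>2\<close>. The minus sign comes from the use of \<open>- ln t\<close> in the kernel.
\<close>
lemma has_real_derivative_log_moment:
  assumes x: "x > 0"
  shows "(log_moment m has_real_derivative - log_moment (Suc m) x) (at x)"
proof -
  note [simp] = set_integrable_log_kernel
  define R where "R h = log_moment m (x + h) - log_moment m x + h * log_moment (Suc m) x" for h
  have R: "\<bar>R h\<bar> \<le> h\<^sup>2 * log_moment (m + 2) (x / 2)" if h: "\<bar>h\<bar> \<le> x / 2" for h
  proof -
    let ?r = "\<lambda>t. log_kernel m (x + h) t - log_kernel m x t + h * log_kernel (Suc m) x t"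
    have xh: "x + h > 0" using h x by linarith
    have int: "set_integrable lborel {0<..<1} ?r"
      using x xh by (intro set_integral_add set_integral_diff set_integrable_mult_right) auto
    have "R h = (LBINT t:{0<..<1}. ?r t)"
      using x xh by (simp add: R_def log_moment_def set_integral_add set_integral_diff)
    then have "\<bar>R h\<bar> \<le> (LBINT t:{0<..<1}. \<bar>?r t\<bar>)"
      using set_integral_norm_bound[OF int] by simp
    also have "\<dots> \<le> (LBINT t:{0<..<1}. h\<^sup>2 * log_kernel (m + 2) (x / 2) t)"
      using x h int by (intro set_integral_mono set_integrable_abs log_kernel_taylor) auto
    finally show ?thesis by (simp add: log_moment_def)
  qed
  have "((\<lambda>h. R h / h) \<longlongrightarrow> 0) (at 0)"
  proof (rule Lim_null_comparison)
    have "\<forall>\<^sub>F h in at 0. \<bar>h\<bar> < x / 2"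
      using x by (auto simp: eventually_at dist_real_def intro!: exI[of _ "x / 2"])
    then show "\<forall>\<^sub>F h in at 0. norm (R h / h) \<le> \<bar>h\<bar> * log_moment (m + 2) (x / 2)"
    proof eventually_elim
      case (elim h)
      then show ?case
        using R[of h] by (cases "h = 0") (simp_all add: field_simps power2_eq_square)
    qed
    show "((\<lambda>h. \<bar>h\<bar> * log_moment (m + 2) (x / 2)) \<longlongrightarrow> 0) (at 0)"
      by (auto intro!: tendsto_eq_intros)
  qed
  then have "((\<lambda>h. R h / h - log_moment (Suc m) x) \<longlongrightarrow> 0 - log_moment (Suc m) x) (at 0)"
    by (intro tendsto_diff tendsto_const)
  moreover have "\<forall>\<^sub>F h in at 0. R h / h - log_moment (Suc m) x
      = (log_moment m (x + h) - log_moment m x) / h"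
    by (auto simp: eventually_at R_def field_simps intro!: exI[of _ 1])
  ultimately show ?thesis
    unfolding DERIV_def by (simp cong: filterlim_cong)
qed

lemma higher_deriv_nielsen_beta:
  assumes "x > 0"
  shows "(deriv ^^ m) nielsen_beta x = (- 1) ^ m * log_moment m x"
  using assms
proof (induction m arbitrary: x)
  case 0
  have "set_lebesgue_integral lborel {0<..<1} (\<lambda>t. t powr (x - 1) / (1 + t)) = log_moment 0 x"
    unfolding log_moment_def by (rule set_lebesgue_integral_cong) (auto simp: log_kernel_def)
  then show ?case by (simp add: nielsen_beta_def)
next
  case (Suc m)
  have "\<forall>\<^sub>F y in nhds x. y > 0"
    using Suc.prems by (intro eventually_nhds_in_open[of "{0<..}", simplified]) auto
  then have "\<forall>\<^sub>F y in nhds x. (deriv ^^ m) nielsen_beta y = (- 1) ^ m * log_moment m y"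
    by eventually_elim (rule Suc.IH)
  then have "(deriv ^^ Suc m) nielsen_beta x = deriv (\<lambda>y. (- 1) ^ m * log_moment m y) x"
    by (auto intro: deriv_cong_ev)
  also have "\<dots> = (- 1) ^ m * (- log_moment (Suc m) x)"
    by (intro DERIV_imp_deriv DERIV_cmult has_real_derivative_log_moment Suc.prems)
  finally show ?case by simp
qed

lemma abs_higher_deriv_nielsen_beta:
  assumes "x > 0"
  shows "\<bar>(deriv ^^ m) nielsen_beta x\<bar> = log_moment m x"
proof -
  have "log_moment m x \<ge> 0"
    unfolding log_moment_def set_lebesgue_integral_def
    by (intro integral_nonneg_AE AE_I2) (auto simp: indicator_def intro: log_kernel_nonneg)
  then show ?thesis
    using higher_deriv_nielsen_beta[OF assms, of m] by (simp add: abs_mult)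
qed

section \<open>The inequality\<close>

text \<open>
  The logarithm of the kernel is
  \<open>m * ln w - (x - 1) * w - ln (1 + t)\<close> with \<open>w = - ln t\<close>, an affine function of
  \<open>(m, x)\<close>, and affine functions commute with averages of total weight one.
\<close>
lemma log_kernel_geometric_mean:
  assumes t: "0 < t" "t < 1" and pq: "p + q = 1"
    and k: "real m * p + real n * q = real k"
  shows "log_kernel k (x * p + y * q) t = log_kernel m x t powr p * log_kernel n y t powr q"
proof -
  define w where "w = - ln t"
  have w: "w > 0" using t by (simp add: w_def)
  have kernel: "log_kernel j z t = exp (real j * ln w + - (z - 1) * w - ln (1 + t))" for j z
  proof -
    have "w ^ j = exp (real j * ln w)" using w by (simp add: exp_of_nat_mult)
    moreover have "t powr (z - 1) = exp (- (z - 1) * w)"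
      using t by (simp add: powr_def w_def algebra_simps)
    moreover have "exp (ln (1 + t)) = 1 + t" using t by simp
    ultimately show ?thesis
      by (simp only: log_kernel_def w_def[symmetric] exp_diff exp_add)
  qed
  have q: "q = 1 - p" using pq by simp
  show ?thesis
    unfolding kernel k[symmetric] by (simp add: powr_def q algebra_simps flip: exp_add)
qed

theorem theorem2p7:
  fixes m n k :: nat and a b x y :: real
  assumes "a > 1"
    and "1 / a + 1 / b = 1"
    and "real m / a + real n / b = real k"
    and "x > 0" and "y > 0"
  shows "\<bar>(deriv ^^ k) nielsen_beta (x / a + y / b)\<bar>
           \<le> \<bar>(deriv ^^ m) nielsen_beta x\<bar> powr (1 / a) * \<bar>(deriv ^^ n) nielsen_beta y\<bar> powr (1 / b)"
proof -
  define p where "p = 1 / a"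
  define q where "q = 1 / b"
  have p: "p > 0" "p < 1" using \<open>a > 1\<close> by (auto simp: p_def)
  have pq: "p + q = 1" using assms(2) by (simp add: p_def q_def)
  have q: "q > 0" using p pq by simp
  have k: "real m * p + real n * q = real k" using assms(3) by (simp add: p_def q_def)
  have z: "x / a + y / b = x * p + y * q" by (simp add: p_def q_def)
  have z0: "x * p + y * q > 0" using assms(4,5) p q by (simp add: add_pos_pos)
  \<comment> \<open>Cutting off by the indicator is compatible with the geometric mean, since
    \<open>0 powr p = 0\<close>.\<close>
  let ?f = "\<lambda>j s t. indicator {0<..<1} t *\<^sub>R log_kernel j s t"
  have int: "integrable lborel (?f j s)" if "s > 0" for j s
    using set_integrable_log_kernel[OF that, of j] by (simp add: set_integrable_def)
  have nonneg: "?f j s t \<ge> 0" for j s t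
    by (auto simp: indicator_def log_kernel_nonneg)
  have "?f k (x * p + y * q) t = ?f m x t powr p * ?f n y t powr q" for t
    using log_kernel_geometric_mean[OF _ _ pq k, of t x y] by (auto simp: indicator_def)
  then have "log_moment k (x * p + y * q) = (LBINT t. ?f m x t powr p * ?f n y t powr q)"
    by (simp add: log_moment_def set_lebesgue_integral_def)
  also have "\<dots> \<le> (LBINT t. ?f m x t) powr p * (LBINT t. ?f n y t) powr q"
    using assms(4,5) by (intro integral_powr_mult_powr_le int nonneg p q pq)
  also have "\<dots> = log_moment m x powr p * log_moment n y powr q"
    by (simp add: log_moment_def set_lebesgue_integral_def)
  finally show ?thesis
    using abs_higher_deriv_nielsen_beta[OF z0] assms(4,5)
    by (simp only: z abs_higher_deriv_nielsen_beta p_def[symmetric] q_def[symmetric])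
qed

end
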